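(* Let $n,d\ge1$ and let $v_1,\dots,v_n\in\mathbb{S}^{d-1}$ be unit vectors in $\mathbb{R}^d$ such that $$\sup_{u\in\mathbb{S}^{d-1}}\prod_{j=1}^n|\langle v_j,u\rangle|=n^{-n/2}.$$ Then $d\ge n$ and $v_1,\dots,v_n$ form an orthonormal set.
   Context: $\langle\cdot,\cdot\rangle$ is the standard inner product on $\mathbb{R}^d$ and $\mathbb{S}^{d-1}$ is the unit sphere of $\mathbb{R}^d$. "Form an orthonormal set" means $\langle v_j,v_k\rangle=\delta_{jk}$ for all $j,k$. *)

theory Defs
  imports "HOL-Analysis.Analysis"
begin

end

theory Submission
  imports Defs "Jordan_Normal_Form.Determinant"
begin

text \<open>
  Write \<open>A\<close> for the Gram matrix of the given vectors and suppose for a moment that it is positive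
  definite. Up to scaling, the critical points with nonzero value of \<open>\<Prod>\<^sub>i \<bar>\<langle>v\<^sub>i, u\<rangle>\<bar>\<close> on the sphere are the points
  \<open>u = \<Sum>\<^sub>j x\<^sub>j v\<^sub>j\<close> for the real solutions \<open>x\<close> of \<open>x\<^sub>i (A x)\<^sub>i = 1\<close>, \<open>i < n\<close>, and there the product equals
  \<open>n\<^sup>-\<^sup>n\<^sup>/\<^sup>2 / \<Prod>\<^sub>i \<bar>x\<^sub>i\<bar>\<close>. Every open orthant contains a solution (\<open>exists_critical_point\<close>),
  so there are \<open>2\<^sup>n\<close> of them, one \<open>x\<^sub>P\<close> for each set \<open>P\<close> of positive coordinates.

  The key is that these \<open>2\<^sup>n\<close> points carry a probability measure \<open>\<mu>\<close> whose mean values satisfy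
  \<open>E [x\<^sub>i x\<^sub>j] = 0\<close> for \<open>i \<noteq> j\<close> and \<open>E [x\<^sub>i\<^sup>2] = 1 / A\<^sub>i\<^sub>i\<close> (\<open>critical_point_moments\<close>). To see this, expand
  \<open>det (I + diag(t) A) = \<Sum>\<^sub>S c\<^sub>S \<Prod>\<^sub>i\<^sub>\<in>\<^sub>S t\<^sub>i\<close>, where \<open>c\<^sub>S\<close> is the principal minor of \<open>A\<close> on \<open>S\<close>, and substitute
  \<open>t = x\<^sub>P x\<^sub>Q\<close>. For \<open>P \<noteq> Q\<close> the vector \<open>x\<^sub>P - x\<^sub>Q\<close> lies in the kernel, so the determinant vanishes; for
  \<open>P = Q\<close> it is positive. Hence the square matrix with rows \<open>P\<close>, columns \<open>S\<close> and entries
  \<open>\<Prod>\<^sub>i\<^sub>\<in>\<^sub>S x\<^sub>P\<^sub>,\<^sub>i\<close> has orthogonal rows for the weights \<open>c\<^sub>S\<close>. As a left inverse of a square matrix is a right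
  inverse, its columns are orthogonal as well, for the weights
  \<open>\<mu>\<^sub>P = 1 / det (I + diag(x\<^sub>P\<^sup>2) A)\<close>. The columns of the empty set and of the singletons give the moments.

  For unit vectors the mean of \<open>\<Sum>\<^sub>i x\<^sub>i\<^sup>2\<close> is therefore \<open>n\<close>. The hypothesis on the supremum says
  that \<open>\<Prod>\<^sub>i \<bar>x\<^sub>i\<bar> \<ge> 1\<close> at each critical point, so \<open>\<Sum>\<^sub>i x\<^sub>i\<^sup>2 \<ge> n\<close> by the inequality of the means. Equality must hold
  throughout and all the \<open>x\<^sub>i\<close> are \<open>\<plusminus>1\<close>. Then \<open>A x = x\<close> for every sign vector \<open>x\<close>, which means \<open>A = I\<close>.

  If \<open>A\<close> is singular, solutions are missing. The argument is therefore carried out for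
  \<open>A + \<delta> I\<close> with all estimates made quantitative: the mean of \<open>\<Sum>\<^sub>i (\<bar>x\<^sub>i\<bar> - 1)\<^sup>2\<close> is
  of order \<open>\<delta>\<close> (\<open>critical_point_deviation\<close>), so the mean of \<open>((A + \<delta> I) x)\<^sub>i\<^sup>2 = 1 / x\<^sub>i\<^sup>2\<close> is at most
  \<open>1 + O(\<delta>)\<close> (\<open>critical_point_reciprocal_bound\<close>). By the moment identities this mean is
  the sum of squares of a row of \<open>A + \<delta> I\<close>, divided by \<open>1 + \<delta>\<close>. So the squares of the off-diagonal entries of \<open>A\<close>
  are \<open>O(\<delta>)\<close>, and letting \<open>\<delta>\<close> tend to \<open>0\<close> they vanish.
\<close>

section \<open>Biorthogonality over a finite index set\<close>

text \<open>
  The matrices \<open>L\<close> and \<open>R\<close> are square, since rows and columns are indexed by the same finite set, so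
  the one-sided inverse given by the assumption is two-sided.
\<close>

lemma biorthogonal_systems_swap:
  fixes L R :: "'a \<Rightarrow> 'a \<Rightarrow> real"
  assumes fin: "finite I"
    and LR: "\<And>i k. i \<in> I \<Longrightarrow> k \<in> I \<Longrightarrow> (\<Sum>j\<in>I. L i j * R j k) = (if i = k then 1 else 0)"
    and i: "i \<in> I" and k: "k \<in> I"
  shows "(\<Sum>j\<in>I. R i j * L j k) = (if i = k then 1 else 0)"
proof -
  define N where "N = card I"
  obtain h where h: "bij_betw h {0..<N} I"
    using ex_bij_betw_nat_finite[OF fin] unfolding N_def by blast
  have hI: "h a \<in> I" if "a < N" for a
    using h that by (auto simp: bij_betw_def)
  have h_inj: "h a = h b \<longleftrightarrow> a = b" if "a < N" "b < N" for a b
    using h that by (auto simp: bij_betw_def inj_on_def)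
  define LM where "LM = Matrix.mat N N (\<lambda>(a, b). L (h a) (h b))"
  define RM where "RM = Matrix.mat N N (\<lambda>(a, b). R (h a) (h b))"
  have carr: "LM \<in> carrier_mat N N" "RM \<in> carrier_mat N N"
    by (auto simp: LM_def RM_def)
  have reindex: "(\<Sum>c = 0..<N. f (h c)) = (\<Sum>j\<in>I. f j)" for f :: "'a \<Rightarrow> real"
    using sum.reindex_bij_betw[OF h, of f] by simp
  have "LM * RM = 1\<^sub>m N"
    by (rule eq_matI)
      (auto simp: LM_def RM_def scalar_prod_def h_inj hI LR
        reindex[where f = "\<lambda>j. L x j * R j y" for x y])
  from mat_mult_left_right_inverse[OF carr this] have eq: "RM * LM = 1\<^sub>m N" .
  obtain a b where ab: "a < N" "b < N" "h a = i" "h b = k"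
    using h i k by (auto simp: bij_betw_def image_iff set_eq_iff) (metis atLeastLessThan_iff)
  have "(\<Sum>j\<in>I. R i j * L j k) = (RM * LM) $$ (a, b)"
    using ab by (auto simp: LM_def RM_def scalar_prod_def 
        reindex[where f = "\<lambda>j. R x j * L j y" for x y])
  also have "\<dots> = (if i = k then 1 else 0)"
    unfolding eq using ab h_inj[of a b] by auto
  finally show ?thesis .
qed

section \<open>Quadratic forms and principal minors\<close>

text \<open>
  Matrices and vectors are functions on the natural numbers of which only the values at indices below \<open>n\<close>
  matter, because \<open>n\<close> is a variable that is unrelated to the dimension of the ambient space.
\<close>

definition mat_app :: "nat \<Rightarrow> (nat \<Rightarrow> nat \<Rightarrow> real) \<Rightarrow> (nat \<Rightarrow> real) \<Rightarrow> nat \<Rightarrow> real" where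
  "mat_app n A x i = (\<Sum>j<n. A i j * x j)"

definition quad_form :: "nat \<Rightarrow> (nat \<Rightarrow> nat \<Rightarrow> real) \<Rightarrow> (nat \<Rightarrow> real) \<Rightarrow> real" where
  "quad_form n A x = (\<Sum>i<n. x i * mat_app n A x i)"

definition positive_definite :: "nat \<Rightarrow> (nat \<Rightarrow> nat \<Rightarrow> real) \<Rightarrow> bool" where
  "positive_definite n A \<longleftrightarrow> (\<forall>x. (\<exists>i<n. x i \<noteq> 0) \<longrightarrow> 0 < quad_form n A x)"

text \<open>
  In the Leibniz formula for the matrix that agrees with \<open>A\<close> in the rows of \<open>S\<close> and with the identity
  elsewhere, the second product forces the permutation to fix all indices outside \<open>S\<close>.
\<close>

definition principal_minor :: "nat \<Rightarrow> (nat \<Rightarrow> nat \<Rightarrow> real) \<Rightarrow> nat set \<Rightarrow> real" where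
  "principal_minor n A S = (\<Sum>\<pi> | \<pi> permutes {0..<n}.
     signof \<pi> * ((\<Prod>i\<in>S. A i (\<pi> i)) * (\<Prod>i\<in>{0..<n} - S. if i = \<pi> i then 1 else 0)))"

text \<open>
  This is \<open>det (I + diag(t) A)\<close>, written as a polynomial that is affine in each \<open>t\<^sub>i\<close>.
\<close>

definition minor_sum :: "nat \<Rightarrow> (nat \<Rightarrow> nat \<Rightarrow> real) \<Rightarrow> (nat \<Rightarrow> real) \<Rightarrow> real" where
  "minor_sum n A t = (\<Sum>S\<in>Pow {0..<n}. principal_minor n A S * (\<Prod>i\<in>S. t i))"

definition shifted_mat where
  "shifted_mat n A t = Matrix.mat n n (\<lambda>(i, j). (t i :: real) * A i j + (if i = j then 1 else 0))"

lemma minor_sum_eq_det: "minor_sum n A t = Determinant.det (shifted_mat n A t)"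
proof -
  have "Determinant.det (shifted_mat n A t) =
    (\<Sum>\<pi> | \<pi> permutes {0..<n}. signof \<pi> * (\<Prod>i = 0..<n. t i * A i (\<pi> i) + (if i = \<pi> i then 1 else 0)))"
    unfolding shifted_mat_def
    by (subst det_def'[of _ n])
      (auto intro!: sum.cong prod.cong simp: permutes_in_image[of _ "{0..<n}", simplified])
  also have "\<dots> = (\<Sum>\<pi> | \<pi> permutes {0..<n}. \<Sum>S\<in>Pow {0..<n}. signof \<pi> *
      (((\<Prod>i\<in>S. A i (\<pi> i)) * (\<Prod>i\<in>{0..<n} - S. if i = \<pi> i then 1 else 0)) * (\<Prod>i\<in>S. t i)))"
    by (auto intro!: sum.cong simp: prod_add sum_distrib_left prod.distrib mult_ac)
  also have "\<dots> = minor_sum n A t"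
    unfolding minor_sum_def principal_minor_def
    by (subst sum.swap) (auto intro!: sum.cong simp: sum_distrib_right sum_distrib_left mult_ac)
  finally show ?thesis by simp
qed

lemma principal_minor_empty: "principal_minor n A {} = 1"
proof -
  have "minor_sum n A (\<lambda>i. 0) = principal_minor n A {}"
    unfolding minor_sum_def
    by (subst sum.remove[of _ "{}"]) (auto intro!: sum.neutral simp: finite_subset prod_zero_iff[OF finite_subset])
  moreover have "shifted_mat n A (\<lambda>i. 0) = 1\<^sub>m n"
    unfolding shifted_mat_def by (rule eq_matI) auto
  ultimately show ?thesis by (simp add: minor_sum_eq_det)
qed

lemma principal_minor_singleton:
  assumes "k < n"
  shows "principal_minor n A {k} = A k k"
proof -
  have "principal_minor n A {k} = (\<Sum>\<pi>\<in>{id}.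
     signof \<pi> * ((\<Prod>i\<in>{k}. A i (\<pi> i)) * (\<Prod>i\<in>{0..<n} - {k}. if i = \<pi> i then 1 else 0)))"
    unfolding principal_minor_def
  proof (rule sum.mono_neutral_right)
    show "\<forall>\<pi>\<in>{\<pi>. \<pi> permutes {0..<n}} - {id}. signof \<pi> * ((\<Prod>i\<in>{k}. A i (\<pi> i)) *
      (\<Prod>i\<in>{0..<n} - {k}. if i = \<pi> i then 1 else 0)) = 0"
    proof
      fix \<pi> assume \<pi>: "\<pi> \<in> {\<pi>. \<pi> permutes {0..<n}} - {id}"
      have "\<exists>i\<in>{0..<n} - {k}. \<pi> i \<noteq> i"
      proof (rule ccontr)
        assume "\<not> ?thesis"
        then have fixed: "\<pi> i = i" if "i \<noteq> k" for i
          using \<pi> that by (cases "i < n") (auto simp: permutes_def)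
        have "\<pi> k = k"
        proof (rule ccontr)
          assume "\<pi> k \<noteq> k"
          then have "\<pi> (\<pi> k) = \<pi> k" using fixed by blast
          then show False using \<open>\<pi> k \<noteq> k\<close> \<pi> permutes_inj by (metis DiffD1 injD mem_Collect_eq)
        qed
        then have "\<pi> = id" using fixed by (metis eq_id_iff)
        then show False using \<pi> by simp
      qed
      then obtain i where "i \<in> {0..<n} - {k}" "\<pi> i \<noteq> i" by blast
      then have "(\<Prod>i\<in>{0..<n} - {k}. if i = \<pi> i then 1 else 0) = (0::real)"
        by (intro prod_zero bexI[of _ i]) auto
      then show "signof \<pi> * ((\<Prod>i\<in>{k}. A i (\<pi> i)) *
        (\<Prod>i\<in>{0..<n} - {k}. if i = \<pi> i then 1 else 0)) = 0"
        by simp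
    qed
  qed (auto simp: finite_permutations permutes_id)
  also have "\<dots> = A k k" by simp
  finally show ?thesis .
qed

lemma minor_sum_eq_0_iff:
  "minor_sum n A t = 0 \<longleftrightarrow> (\<exists>w. (\<exists>i<n. w i \<noteq> 0) \<and> (\<forall>i<n. w i + t i * mat_app n A w i = 0))"
proof -
  have carr: "shifted_mat n A t \<in> carrier_mat n n" by (simp add: shifted_mat_def)
  have row: "vec_index (shifted_mat n A t *\<^sub>v u) i = vec_index u i + t i * mat_app n A (vec_index u) i"
    if i: "i < n" and u: "u \<in> carrier_vec n" for u i
  proof -
    have "vec_index (shifted_mat n A t *\<^sub>v u) i
        = (\<Sum>j<n. (t i * A i j + (if i = j then 1 else 0)) * vec_index u j)"
      using i u by (simp add: shifted_mat_def scalar_prod_def atLeast0LessThan)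
    also have "\<dots> = (\<Sum>j<n. t i * (A i j * vec_index u j) + (if i = j then vec_index u j else 0))"
      by (intro sum.cong) (auto simp: algebra_simps)
    finally show ?thesis
      using i by (simp add: mat_app_def sum.distrib sum_distrib_left)
  qed
  show ?thesis
    unfolding minor_sum_eq_det det_0_iff_vec_prod_zero[OF carr]
  proof
    assume "\<exists>u. u \<in> carrier_vec n \<and> u \<noteq> 0\<^sub>v n \<and> shifted_mat n A t *\<^sub>v u = 0\<^sub>v n"
    then obtain u where u: "u \<in> carrier_vec n" "u \<noteq> 0\<^sub>v n" "shifted_mat n A t *\<^sub>v u = 0\<^sub>v n" by blast
    then have "\<exists>i<n. vec_index u i \<noteq> 0" by (auto simp: vec_eq_iff)
    moreover have "\<forall>i<n. vec_index u i + t i * mat_app n A (vec_index u) i = 0"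
      using row[OF _ u(1)] u(3) by simp
    ultimately show "\<exists>w. (\<exists>i<n. w i \<noteq> 0) \<and> (\<forall>i<n. w i + t i * mat_app n A w i = 0)" by blast
  next
    assume "\<exists>w. (\<exists>i<n. w i \<noteq> 0) \<and> (\<forall>i<n. w i + t i * mat_app n A w i = 0)"
    then obtain w where w: "\<exists>i<n. w i \<noteq> 0" "\<forall>i<n. w i + t i * mat_app n A w i = 0" by blast
    have app: "mat_app n A (vec_index (Matrix.vec n w)) i = mat_app n A w i" for i
      by (simp add: mat_app_def)
    have "shifted_mat n A t *\<^sub>v Matrix.vec n w = 0\<^sub>v n"
      using carr by (intro eq_vecI) (use row[of _ "Matrix.vec n w"] app w(2) in auto)
    moreover have "Matrix.vec n w \<noteq> 0\<^sub>v n" using w(1) by (auto simp: vec_eq_iff)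
    ultimately show "\<exists>u. u \<in> carrier_vec n \<and> u \<noteq> 0\<^sub>v n \<and> shifted_mat n A t *\<^sub>v u = 0\<^sub>v n"
      by (meson vec_carrier)
  qed
qed

lemma mat_app_scale: "mat_app n A (\<lambda>i. c * x i) i = c * mat_app n A x i"
  by (simp add: mat_app_def sum_distrib_left mult_ac)

lemma mat_app_diff: "mat_app n A (\<lambda>i. x i - y i) i = mat_app n A x i - mat_app n A y i"
  by (simp add: mat_app_def algebra_simps sum_subtractf)

text \<open>
  Along the segment from \<open>0\<close> to \<open>t\<close> the determinant starts at \<open>1\<close> and never vanishes: a kernel vector \<open>w\<close> would
  satisfy \<open>\<Sum>\<^sub>i w\<^sub>i\<^sup>2 / t\<^sub>i + s \<langle>w, A w\<rangle> = 0\<close>.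
\<close>

lemma minor_sum_pos:
  assumes pd: "positive_definite n A" and t: "\<And>i. i < n \<Longrightarrow> 0 < t i"
  shows "0 < minor_sum n A t"
proof -
  define f where "f s = minor_sum n A (\<lambda>i. s * t i)" for s
  have cont: "continuous_on {0..1} f"
    unfolding f_def minor_sum_def by (intro continuous_intros)
  have nz: "f s \<noteq> 0" if s: "0 \<le> s" for s
  proof
    assume "f s = 0"
    then obtain w k where k: "k < n" "w k \<noteq> 0" and w: "\<forall>i<n. w i + s * t i * mat_app n A w i = 0"
      unfolding f_def minor_sum_eq_0_iff by blast
    have "w i * w i / t i + s * (w i * mat_app n A w i) = 0" if "i < n" for i
    proof -
      have "w i * w i / t i + s * (w i * mat_app n A w i) = w i / t i * (w i + s * t i * mat_app n A w i)"
        using t[OF that] by (simp add: field_simps)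
      then show ?thesis using w that by simp
    qed
    then have "(\<Sum>i<n. w i * w i / t i) + s * quad_form n A w = 0"
      unfolding quad_form_def sum_distrib_left sum.distrib[symmetric] by (intro sum.neutral) auto
    moreover have "0 < (\<Sum>i<n. w i * w i / t i)"
      by (rule sum_pos2[of _ k]) (use k t in \<open>auto simp: zero_less_mult_iff zero_le_mult_iff less_imp_le divide_pos_pos not_less linorder_neq_iff\<close>)
    moreover have "0 < quad_form n A w" using pd k by (auto simp: positive_definite_def)
    ultimately show False using s by (smt (verit) mult_nonneg_nonneg)
  qed
  have "f 0 = 1"
  proof -
    have "shifted_mat n A (\<lambda>i. 0) = 1\<^sub>m n"
      unfolding shifted_mat_def by (rule eq_matI) auto
    then show ?thesis by (simp add: f_def minor_sum_eq_det)
  qed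
  moreover have "f 1 = minor_sum n A t" by (simp add: f_def)
  moreover have "\<not> f 1 \<le> 0"
  proof
    assume "f 1 \<le> 0"
    then obtain s where "0 \<le> s" "s \<le> 1" "f s = 0"
      using IVT2'[of f 1 0 0] cont \<open>f 0 = 1\<close> by auto
    then show False using nz by blast
  qed
  ultimately show ?thesis by simp
qed

section \<open>A critical point in every orthant\<close>

lemma quad_form_cong: "(\<And>i. i < n \<Longrightarrow> x i = y i) \<Longrightarrow> quad_form n A x = quad_form n A y"
  by (simp add: quad_form_def mat_app_def)

lemma quad_form_scale: "quad_form n A (\<lambda>i. c * x i) = c\<^sup>2 * quad_form n A x"
  by (simp add: quad_form_def mat_app_scale sum_distrib_left power2_eq_square mult_ac)

lemma quad_form_perturb:
  assumes sym: "\<And>i j. i < n \<Longrightarrow> j < n \<Longrightarrow> A i j = A j i" and k: "k < n"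
  shows "quad_form n A (x(k := x k + h)) = quad_form n A x + 2 * h * mat_app n A x k + h\<^sup>2 * A k k"
proof -
  have upd: "(x(k := x k + h)) i = x i + (if i = k then h else 0)" for i by simp
  have app: "mat_app n A (x(k := x k + h)) i = mat_app n A x i + A i k * h" for i
  proof -
    have "mat_app n A (x(k := x k + h)) i = (\<Sum>j<n. A i j * x j + (if j = k then A i k * h else 0))"
      unfolding mat_app_def upd by (intro sum.cong) (auto simp: algebra_simps)
    then show ?thesis using k by (simp add: mat_app_def sum.distrib)
  qed
  have "quad_form n A (x(k := x k + h)) = (\<Sum>i<n. x i * mat_app n A x i + h * (A i k * x i)
     + (if i = k then h * mat_app n A x i + h\<^sup>2 * A i k else 0))"
    unfolding quad_form_def app upd by (intro sum.cong) (auto simp: algebra_simps power2_eq_square)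
  also have "\<dots> = quad_form n A x + h * (\<Sum>i<n. A i k * x i) + (h * mat_app n A x k + h\<^sup>2 * A k k)"
    using k by (simp add: quad_form_def sum.distrib sum_distrib_left)
  also have "(\<Sum>i<n. A i k * x i) = mat_app n A x k"
    unfolding mat_app_def using sym k by (intro sum.cong) auto
  finally have "quad_form n A (x(k := x k + h)) =
      quad_form n A x + h * mat_app n A x k + (h * mat_app n A x k + h\<^sup>2 * A k k)" .
  then show ?thesis by linarith
qed

text \<open>
  In the orthant with sign pattern \<open>P\<close>, a maximum of the function \<open>\<Prod>\<^sub>i x\<^sub>i\<^sup>2 / \<langle>x, A x\<rangle>\<^sup>n\<close>, which is homogeneous of
  degree \<open>0\<close>, exists by compactness of the sphere. It lies in the interior, and there the partial derivatives
  vanish, which says \<open>n x\<^sub>k (A x)\<^sub>k = \<langle>x, A x\<rangle>\<close>. Rescaling makes the common value of \<open>x\<^sub>k (A x)\<^sub>k\<close> equal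
  to \<open>1\<close>.
\<close>

lemma exists_critical_point:
  assumes n: "0 < n" and sym: "\<And>i j. i < n \<Longrightarrow> j < n \<Longrightarrow> A i j = A j i" and pd: "positive_definite n A"
  shows "\<exists>x. (\<forall>i<n. x i * mat_app n A x i = 1) \<and> (\<forall>i<n. 0 < x i \<longleftrightarrow> i \<in> P)"
proof -
  define s :: "nat \<Rightarrow> real" where "s i = (if i \<in> P then 1 else -1)" for i
  have s2: "s i * s i = 1" "s i \<noteq> 0" "(s i)\<^sup>2 = 1" for i by (auto simp: s_def)
  define B :: "(nat \<Rightarrow> real) set" where "B = Pi\<^sub>E UNIV (\<lambda>i. if i < n then {-1..1} else {0})"
  define K where "K = B \<inter> {x. \<forall>i<n. 0 \<le> s i * x i} \<inter> {x. (\<Sum>i<n. (x i)\<^sup>2) = 1}"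
  define F where "F x = (\<Prod>i<n. (x i)\<^sup>2) / quad_form n A x ^ n" for x
  have "compactin (product_topology (\<lambda>i. euclidean) UNIV) B"
    unfolding B_def compactin_PiE by auto
  then have "compact B" by (simp add: euclidean_product_topology)
  moreover have "closed {x :: nat \<Rightarrow> real. \<forall>i<n. 0 \<le> s i * x i}"
    by (intro closed_Collect_all closed_Collect_imp closed_Collect_le continuous_intros) auto
  moreover have "closed {x :: nat \<Rightarrow> real. (\<Sum>i<n. (x i)\<^sup>2) = 1}"
    by (intro closed_Collect_eq continuous_intros) auto
  ultimately have "compact K" unfolding K_def by blast
  have qpos: "0 < quad_form n A x" if "x \<in> K" for x
  proof -
    have "\<exists>i<n. x i \<noteq> 0"
    proof (rule ccontr)
      assume "\<not> ?thesis"
      then have "(\<Sum>i<n. (x i)\<^sup>2) = 0" by (intro sum.neutral) auto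
      then show False using that by (simp add: K_def)
    qed
    then show ?thesis using pd by (simp add: positive_definite_def)
  qed
  have "continuous_on K F"
    unfolding F_def using qpos
    by (intro continuous_on_divide continuous_on_power)
      (auto simp: quad_form_def mat_app_def less_imp_neq[symmetric]
        intro!: continuous_intros continuous_on_subset[OF continuous_on_product_coordinates])
  (* A point with positive value, so that the maximum is positive and not on a coordinate hyperplane. *)
  define e where "e i = (if i < n then s i / sqrt n else 0)" for i
  have e: "e \<in> K"
  proof -
    have "\<bar>s i / sqrt n\<bar> \<le> 1" for i
      using n by (simp add: s_def divide_le_eq)
    then have "- 1 \<le> s i / sqrt n \<and> s i / sqrt n \<le> 1" for i
      by (metis abs_le_iff minus_le_iff)
    then have "e \<in> B" unfolding B_def e_def by (intro PiE_I) (simp_all only: UNIV_I if_True if_False atLeastAtMost_iff not_True_eq_False singletonI split: if_split, blast)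
    then show ?thesis using n s2 by (simp add: K_def e_def power_divide)
  qed
  have Fe: "0 < F e"
    using qpos[OF e] n s2 by (auto simp: F_def e_def intro!: divide_pos_pos prod_pos)
  obtain x where x: "x \<in> K" and max: "\<And>y. y \<in> K \<Longrightarrow> F y \<le> F x"
    using continuous_attains_sup[OF \<open>compact K\<close> _ \<open>continuous_on K F\<close>] e by blast
  define Q where "Q = quad_form n A x"
  have Q: "0 < Q" using qpos[OF x] by (simp add: Q_def)
  have Fx: "0 < F x" using Fe max[OF e] by simp
  have sx: "0 < s i * x i" if "i < n" for i
  proof -
    have "(\<Prod>i<n. (x i)\<^sup>2) \<noteq> 0" using Fx unfolding F_def by (metis div_0 less_irrefl)
    then have "x i \<noteq> 0" using that by (auto simp: prod_zero_iff)
    then show ?thesis using x that s2(2) by (auto simp: K_def order_less_le)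
  qed
  (* By homogeneity, the maximum over the sphere is a maximum over the whole open orthant. *)
  have max_orthant: "F z \<le> F x" if z: "\<And>i. i < n \<Longrightarrow> 0 < s i * z i" for z
  proof -
    define r where "r = sqrt (\<Sum>i<n. (z i)\<^sup>2)"
    have znz: "z i \<noteq> 0" if "i < n" for i using z[OF that] by auto
    have "0 < (\<Sum>i<n. (z i)\<^sup>2)" using n znz by (intro sum_pos) auto
    then have r: "0 < r" "r\<^sup>2 = (\<Sum>i<n. (z i)\<^sup>2)" by (auto simp: r_def)
    define y where "y i = (if i < n then (1 / r) * z i else 0)" for i
    have sumy: "(\<Sum>i<n. (y i)\<^sup>2) = 1"
    proof -
      have "(\<Sum>i<n. (y i)\<^sup>2) = (\<Sum>i<n. (z i)\<^sup>2) / r\<^sup>2"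
        by (simp add: y_def power_divide sum_divide_distrib)
      then show ?thesis using r by (metis divide_self_if power_not_zero less_irrefl)
    qed
    have "\<bar>y i\<bar> \<le> 1" if "i < n" for i
    proof -
      have "(y i)\<^sup>2 \<le> (\<Sum>i<n. (y i)\<^sup>2)" using that by (intro member_le_sum) auto
      then show ?thesis unfolding sumy by (simp add: abs_square_le_1)
    qed
    then have "- 1 \<le> y i \<and> y i \<le> 1" if "i < n" for i
      using that by (metis abs_le_iff minus_le_iff)
    then have "y \<in> B" unfolding B_def by (intro PiE_I) (auto simp: y_def)
    then have "y \<in> K" using z r sumy by (auto simp: K_def y_def less_imp_le divide_nonneg_pos)
    moreover have "F y = F z"
    proof -
      have "quad_form n A y = (1 / r)\<^sup>2 * quad_form n A z"
        unfolding quad_form_scale[symmetric] by (rule quad_form_cong) (simp add: y_def)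
      moreover have "(\<Prod>i<n. (y i)\<^sup>2) = ((1 / r)\<^sup>2) ^ n * (\<Prod>i<n. (z i)\<^sup>2)"
        by (simp add: y_def power_mult_distrib prod.distrib power_divide prod_dividef)
      ultimately show ?thesis
        using r by (simp add: F_def power_mult_distrib)
    qed
    ultimately show ?thesis using max by metis
  qed
  have eq: "Q = n * (x k * mat_app n A x k)" if k: "k < n" for k
  proof -
    define c where "c = (\<Prod>i\<in>{..<n} - {k}. (x i)\<^sup>2)"
    define b where "b = mat_app n A x k"
    have xk: "x k \<noteq> 0" using sx[OF k] by auto
    have c: "c \<noteq> 0" using sx by (fastforce simp: c_def prod_zero_iff)
    (* The objective along the k-th coordinate direction; it has a local maximum at h = 0. *)
    define f where "f h = c * (x k + h)\<^sup>2 / (Q + 2 * h * b + h\<^sup>2 * A k k) ^ n" for h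
    have f: "f h = F (x(k := x k + h))" for h
    proof -
      have "quad_form n A (x(k := x k + h)) = Q + 2 * h * b + h\<^sup>2 * A k k"
        unfolding Q_def b_def using sym k by (rule quad_form_perturb)
      moreover have "(\<Prod>i<n. ((x(k := x k + h)) i)\<^sup>2) = c * (x k + h)\<^sup>2"
        using k by (simp add: c_def prod.remove[of "{..<n}" k] mult.commute)
      ultimately show ?thesis by (simp only: f_def F_def)
    qed
    have "DERIV f 0 :> (c * (2 * x k) * Q ^ n - c * (x k)\<^sup>2 * (n * Q ^ (n - 1) * (2 * b))) / (Q ^ n * Q ^ n)"
      unfolding f_def using Q by (auto intro!: derivative_eq_intros)
    moreover have "f h \<le> f 0" if "\<bar>0 - h\<bar> < \<bar>x k\<bar>" for h
    proof -
      have "0 < s k * (x k + h)"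
        using sx[OF k] that by (auto simp: s_def split: if_splits)
      then have "F (x(k := x k + h)) \<le> F x" using sx by (intro max_orthant) auto
      then show ?thesis by (simp add: f)
    qed
    ultimately have "(c * (2 * x k) * Q ^ n - c * (x k)\<^sup>2 * (n * Q ^ (n - 1) * (2 * b))) / (Q ^ n * Q ^ n) = 0"
      using xk by (intro DERIV_local_max[of f _ 0 "\<bar>x k\<bar>"]) auto
    then have "c * (2 * x k) * Q ^ n - c * (x k)\<^sup>2 * (n * Q ^ (n - 1) * (2 * b)) = 0"
      using Q by (metis divide_eq_0_iff mult_eq_0_iff power_not_zero less_irrefl)
    moreover have "Q ^ n = Q * Q ^ (n - 1)" using n by (simp add: power_eq_if)
    ultimately have "(c * (2 * x k) * Q ^ (n - 1)) * (Q - n * (x k * b)) = 0"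
      by (simp only:) (simp add: algebra_simps power2_eq_square)
    then show ?thesis using c xk Q by (simp add: b_def)
  qed
  define z where "z i = sqrt (n / Q) * x i" for i
  have "z i * mat_app n A z i = 1" if "i < n" for i
  proof -
    have "z i * mat_app n A z i = (sqrt (n / Q))\<^sup>2 * (x i * mat_app n A x i)"
      unfolding z_def mat_app_scale by (simp only: power2_eq_square mult_ac)
    also have "\<dots> = (n * (x i * mat_app n A x i)) / Q"
      using Q n by (simp add: real_sqrt_pow2)
    also have "\<dots> = 1" unfolding eq[OF that, symmetric] using Q by simp
    finally show ?thesis .
  qed
  moreover have "0 < z i \<longleftrightarrow> i \<in> P" if "i < n" for i
  proof -
    have "0 < sqrt (n / Q)" using Q n by simp
    then show ?thesis
      using sx[OF that] unfolding z_def s_def by (auto simp only: zero_less_mult_iff split: if_splits)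
  qed
  ultimately show ?thesis by blast
qed

section \<open>Moments of the critical points\<close>

text \<open>
  The measure \<open>\<mu>\<close> replaces a residue computation: the identities are global residues, in the spirit of
  the Euler-Jacobi theorem, for the system \<open>x\<^sub>i (A x)\<^sub>i = 1\<close>, all of whose \<open>2\<^sup>n\<close> solutions are real.
\<close>

lemma critical_point_moments:
  assumes n: "0 < n" and sym: "\<And>i j. i < n \<Longrightarrow> j < n \<Longrightarrow> A i j = A j i" and pd: "positive_definite n A"
  obtains x :: "nat set \<Rightarrow> nat \<Rightarrow> real" and \<mu> :: "nat set \<Rightarrow> real"
  where "\<And>P i. i < n \<Longrightarrow> x P i * mat_app n A (x P) i = 1"
    and "\<And>P. 0 \<le> \<mu> P"
    and "(\<Sum>P\<in>Pow {0..<n}. \<mu> P) = 1"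
    and "\<And>i j. i < n \<Longrightarrow> j < n \<Longrightarrow>
      (\<Sum>P\<in>Pow {0..<n}. \<mu> P * (x P i * x P j)) * A j j = (if i = j then 1 else 0)"
proof -
  have "\<exists>x. \<forall>P. (\<forall>i<n. x P i * mat_app n A (x P) i = 1) \<and> (\<forall>i<n. 0 < x P i \<longleftrightarrow> i \<in> P)"
    using exists_critical_point[OF assms] by metis
  then obtain x :: "nat set \<Rightarrow> nat \<Rightarrow> real" where
    crit: "\<And>P i. i < n \<Longrightarrow> x P i * mat_app n A (x P) i = 1" and
    sign: "\<And>P i. i < n \<Longrightarrow> 0 < x P i \<longleftrightarrow> i \<in> P" by blast
  define I where "I = Pow {0..<n}"
  define \<mu> where "\<mu> P = 1 / minor_sum n A (\<lambda>i. (x P i)\<^sup>2)" for P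
  have nz: "x P i \<noteq> 0" if "i < n" for P i using crit[OF that, of P] by auto
  have d: "0 < minor_sum n A (\<lambda>i. (x P i)\<^sup>2)" for P
    using nz by (intro minor_sum_pos[OF pd]) auto
  (* The difference of two distinct solutions is a kernel vector. *)
  have cross: "minor_sum n A (\<lambda>i. x P i * x Q i) = 0" if "P \<in> I" "Q \<in> I" "P \<noteq> Q" for P Q
  proof -
    have "\<exists>i<n. x P i - x Q i \<noteq> 0"
    proof (rule ccontr)
      assume "\<not> ?thesis"
      then have "x P i = x Q i" if "i < n" for i using that by simp
      then have "i \<in> P \<longleftrightarrow> i \<in> Q" if "i < n" for i using sign that by metis
      then have "P = Q" using that(1,2) unfolding I_def by fastforce
      then show False using that(3) by simp
    qed
    moreover have "(x P i - x Q i) + x P i * x Q i * mat_app n A (\<lambda>i. x P i - x Q i) i = 0"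
      if "i < n" for i
    proof -
      have "(x P i - x Q i) + x P i * x Q i * mat_app n A (\<lambda>i. x P i - x Q i) i =
        x P i - x Q i + x Q i * (x P i * mat_app n A (x P) i) - x P i * (x Q i * mat_app n A (x Q) i)"
        by (simp add: mat_app_diff algebra_simps)
      then show ?thesis using crit[OF that] by simp
    qed
    ultimately show ?thesis
      unfolding minor_sum_eq_0_iff by (intro exI[of _ "\<lambda>i. x P i - x Q i"] conjI allI impI)
  qed
  have orth: "(\<Sum>P\<in>I. (\<Prod>i\<in>S. x P i) * (\<mu> P * (\<Prod>i\<in>T. x P i) * principal_minor n A T))
      = (if S = T then 1 else 0)" if "S \<in> I" "T \<in> I" for S T
  proof (rule biorthogonal_systems_swap[OF _ _ that, where R = "\<lambda>S P. \<Prod>i\<in>S. x P i"])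
    fix P Q assume PQ: "P \<in> I" "Q \<in> I"
    have "(\<Sum>S\<in>I. \<mu> P * (\<Prod>i\<in>S. x P i) * principal_minor n A S * (\<Prod>i\<in>S. x Q i))
        = \<mu> P * minor_sum n A (\<lambda>i. x P i * x Q i)"
      unfolding minor_sum_def I_def by (simp add: sum_distrib_left prod.distrib mult_ac)
    also have "\<dots> = (if P = Q then 1 else 0)"
      using cross[OF PQ] d[of P] by (auto simp: \<mu>_def power2_eq_square)
    finally show "(\<Sum>S\<in>I. \<mu> P * (\<Prod>i\<in>S. x P i) * principal_minor n A S * (\<Prod>i\<in>S. x Q i))
        = (if P = Q then 1 else 0)" .
  qed (simp add: I_def)
  show ?thesis
  proof
    show "x P i * mat_app n A (x P) i = 1" if "i < n" for P i using crit[OF that] .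
    show "0 \<le> \<mu> P" for P using d[of P] by (simp add: \<mu>_def)
    show "(\<Sum>P\<in>Pow {0..<n}. \<mu> P) = 1"
      using orth[of "{}" "{}"] by (simp add: I_def principal_minor_empty)
    show "(\<Sum>P\<in>Pow {0..<n}. \<mu> P * (x P i * x P j)) * A j j = (if i = j then 1 else 0)"
      if "i < n" "j < n" for i j
      using orth[of "{i}" "{j}"] that
      by (simp add: I_def principal_minor_singleton sum_distrib_left sum_distrib_right mult_ac)
  qed
qed

section \<open>Near-equality at the critical points\<close>

text \<open>
  Let \<open>w\<^sub>i = \<delta> x\<^sub>i\<^sup>2\<close>. Since \<open>(A x)\<^sub>i = (1 - w\<^sub>i) / x\<^sub>i\<close>, the bound on the product gives
  \<open>\<Prod>\<^sub>i \<bar>x\<^sub>i\<bar> \<ge> \<Prod>\<^sub>i \<bar>1 - w\<^sub>i\<bar>\<close>. After taking logarithms this bounds \<open>\<Sum>\<^sub>i \<bar>x\<^sub>i\<bar>\<close> from below by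
  \<open>n - 2 \<Sum>\<^sub>i w\<^sub>i\<close>, as long as no \<open>w\<^sub>i\<close> exceeds \<open>1/2\<close>. If some \<open>w\<^sub>i\<close> does, then \<open>\<bar>x\<^sub>i\<bar> \<ge> n\<close> because \<open>\<delta>\<close> is small, and the
  same bound holds for a trivial reason.
\<close>

lemma critical_point_deviation:
  assumes n: "0 < n" and \<delta>: "0 < \<delta>" "\<delta> * (2 * real n ^ 2) \<le> 1"
    and crit: "\<And>i. i < n \<Longrightarrow> x i * (mat_app n A x i + \<delta> * x i) = 1"
    and psd: "0 \<le> quad_form n A x"
    and bound: "(\<Prod>i<n. (mat_app n A x i)\<^sup>2) \<le> (quad_form n A x / n) ^ n"
  shows "(\<Sum>i<n. (\<bar>x i\<bar> - 1)\<^sup>2) \<le> (\<Sum>i<n. (x i)\<^sup>2) - n + 4 * \<delta> * (\<Sum>i<n. (x i)\<^sup>2)"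
proof -
  have nz: "x i \<noteq> 0" if "i < n" for i using crit[OF that] by auto
  have app: "mat_app n A x i = (1 - \<delta> * (x i)\<^sup>2) / x i" if "i < n" for i
    using crit[OF that] nz[OF that] by (simp add: field_simps power2_eq_square)
  have "quad_form n A x = (\<Sum>i<n. 1 - \<delta> * (x i)\<^sup>2)"
    unfolding quad_form_def by (intro sum.cong) (auto simp: app nz)
  then have "quad_form n A x \<le> n"
    using \<delta>(1) by (simp add: sum_subtractf sum_nonneg)
  then have "(quad_form n A x / n) ^ n \<le> 1"
    using n psd by (intro power_le_one) auto
  with bound have le1: "(\<Prod>i<n. (mat_app n A x i)\<^sup>2) \<le> 1" by linarith
  have "n - 2 * \<delta> * (\<Sum>i<n. (x i)\<^sup>2) \<le> (\<Sum>i<n. \<bar>x i\<bar>)"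
  proof (cases "\<forall>i<n. \<delta> * (x i)\<^sup>2 \<le> 1 / 2")
    case True
    have pos: "0 < (mat_app n A x i)\<^sup>2" if "i < n" for i
    proof -
      have "\<delta> * (x i)\<^sup>2 < 1" using True that by fastforce
      then show ?thesis using app[OF that] nz[OF that] by simp
    qed
    have "(\<Sum>i<n. ln ((mat_app n A x i)\<^sup>2)) = ln (\<Prod>i<n. (mat_app n A x i)\<^sup>2)"
      using pos by (subst ln_prod) fastforce+
    also have "\<dots> \<le> 0"
      using le1 pos by (subst ln_le_zero_iff) (auto intro!: prod_pos)
    finally have "(\<Sum>i<n. ln ((mat_app n A x i)\<^sup>2)) \<le> 0" .
    moreover have "(\<Sum>i<n. 2 * (1 - \<bar>x i\<bar> - 2 * \<delta> * (x i)\<^sup>2)) \<le> (\<Sum>i<n. ln ((mat_app n A x i)\<^sup>2))"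
    proof (rule sum_mono)
      fix i assume "i \<in> {..<n}"
      then have i: "i < n" by simp
      define w where "w = \<delta> * (x i)\<^sup>2"
      have w: "0 \<le> w" "w \<le> 1 / 2" using True i \<delta> by (auto simp: w_def)
      have "(mat_app n A x i)\<^sup>2 = ((1 - w) / \<bar>x i\<bar>)\<^sup>2"
        using app[OF i] by (simp add: w_def power_divide)
      then have "ln ((mat_app n A x i)\<^sup>2) = 2 * (ln (1 - w) - ln \<bar>x i\<bar>)"
        using w nz[OF i] by (simp add: ln_realpow ln_div)
      moreover have "- w - 2 * w\<^sup>2 \<le> ln (1 - w)" using w by (rule ln_one_minus_pos_lower_bound)
      moreover have "2 * w\<^sup>2 \<le> w" using w mult_left_mono[of "2 * w" 1 w] by (simp add: power2_eq_square mult_ac)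
      moreover have "ln \<bar>x i\<bar> \<le> \<bar>x i\<bar> - 1" using nz[OF i] by (intro ln_le_minus_one) auto
      ultimately have "2 * (1 - \<bar>x i\<bar> - 2 * w) \<le> ln ((mat_app n A x i)\<^sup>2)"
        by (simp only: right_diff_distrib)
      then show "2 * (1 - \<bar>x i\<bar> - 2 * \<delta> * (x i)\<^sup>2) \<le> ln ((mat_app n A x i)\<^sup>2)"
        by (simp add: w_def mult.assoc)
    qed
    ultimately have "(\<Sum>i<n. 1 - \<bar>x i\<bar> - 2 * \<delta> * (x i)\<^sup>2) \<le> 0"
      by (simp only: sum_distrib_left[symmetric])
    then show ?thesis by (simp add: sum_subtractf sum_distrib_left)
  next
    case False
    then obtain k where k: "k < n" "1 / 2 < \<delta> * (x k)\<^sup>2" by auto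
    have "\<delta> * real n ^ 2 < \<delta> * (x k)\<^sup>2" using k(2) \<delta>(2) by linarith
    then have "real n ^ 2 \<le> \<bar>x k\<bar>\<^sup>2" using \<delta> by simp
    then have "real n \<le> \<bar>x k\<bar>" by (rule power2_le_imp_le) simp
    also have "\<dots> \<le> (\<Sum>i<n. \<bar>x i\<bar>)" using k by (intro member_le_sum) auto
    finally show ?thesis using \<delta>(1) by (smt (verit) mult_nonneg_nonneg sum_nonneg zero_le_power2)
  qed
  moreover have "(\<Sum>i<n. (\<bar>x i\<bar> - 1)\<^sup>2) = (\<Sum>i<n. (x i)\<^sup>2) - 2 * (\<Sum>i<n. \<bar>x i\<bar>) + n"
    by (simp add: power2_diff sum.distrib sum_subtractf sum_distrib_left)
  ultimately show ?thesis by linarith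
qed

lemma inverse_square_le_quadratic:
  fixes b :: real
  assumes "- 1 / 2 \<le> b"
  shows "1 / (1 + b)\<^sup>2 \<le> 1 - 2 * b + 12 * b\<^sup>2"
proof -
  have "0 \<le> b\<^sup>2 * (9 + 22 * b + 12 * b\<^sup>2)"
  proof (intro mult_nonneg_nonneg)
    have "0 \<le> b + 1 / 2" using assms by simp
    moreover have "0 \<le> 12 * (b + 1 / 2) + 10" using assms by simp
    ultimately have "0 \<le> (b + 1 / 2) * (12 * (b + 1 / 2) + 10)"
      by (rule mult_nonneg_nonneg)
    then show "0 \<le> 9 + 22 * b + 12 * b\<^sup>2" by (simp add: algebra_simps power2_eq_square)
  qed simp
  then have "1 \<le> (1 - 2 * b + 12 * b\<^sup>2) * (1 + b)\<^sup>2"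
    by (simp add: algebra_simps power2_eq_square)
  then show ?thesis using assms by (simp add: divide_le_eq)
qed

text \<open>
  If \<open>\<bar>x\<^sub>i\<bar> \<ge> 1/2\<close>, then \<open>(M x)\<^sub>i\<^sup>2 = 1 / x\<^sub>i\<^sup>2\<close> is compared with its expansion at \<open>\<bar>x\<^sub>i\<bar> = 1\<close>, where the linear term is
  traded for a multiple of \<open>x\<^sub>i\<^sup>2 - 1\<close> and a square because the mean of \<open>x\<^sub>i\<^sup>2\<close> is known exactly. Reciprocals of smaller \<open>x\<^sub>i\<close> are
  controlled by the linear expression \<open>(M x)\<^sub>i\<close>, whose square is at most of the order of
  \<open>\<Sum>\<^sub>j x\<^sub>j\<^sup>2\<close>; in that case the deviation sum is at least \<open>1/4\<close> and dominates it.
\<close>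

lemma critical_point_reciprocal_bound:
  assumes n: "0 < n" and i: "i < n"
    and M: "\<And>j. j < n \<Longrightarrow> \<bar>M i j\<bar> \<le> 2"
    and crit: "x i * mat_app n M x i = 1"
  shows "(mat_app n M x i)\<^sup>2 \<le> 2 - (x i)\<^sup>2 + (13 + 40 * real n ^ 2) * (\<Sum>j<n. (\<bar>x j\<bar> - 1)\<^sup>2)"
proof -
  define D where "D = (\<Sum>j<n. (\<bar>x j\<bar> - 1)\<^sup>2)"
  define b where "b = \<bar>x i\<bar> - 1"
  have b: "b\<^sup>2 \<le> D"
    unfolding b_def D_def using i by (intro member_le_sum) auto
  then have D: "0 \<le> D" by (meson order_trans zero_le_power2)
  have nD: "0 \<le> real n ^ 2 * D" using D by simp
  have xb: "(x i)\<^sup>2 = (1 + b)\<^sup>2" by (simp add: b_def)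
  show ?thesis
  proof (cases "1 / 2 \<le> \<bar>x i\<bar>")
    case True
    have "(mat_app n M x i)\<^sup>2 = 1 / (x i)\<^sup>2"
      using crit by (metis nonzero_eq_divide_eq mult_zero_left mult.commute power_one_over zero_neq_one)
    also have "\<dots> \<le> 1 - 2 * b + 12 * b\<^sup>2"
      unfolding xb using True by (intro inverse_square_le_quadratic) (simp add: b_def)
    also have "\<dots> = 2 - (x i)\<^sup>2 + 13 * b\<^sup>2" unfolding xb power2_sum by simp
    also have "\<dots> \<le> 2 - (x i)\<^sup>2 + (13 * D + 40 * (real n ^ 2 * D))" using b nD by linarith
    finally show ?thesis by (simp add: D_def algebra_simps)
  next
    case False
    have "1 / 4 \<le> D"
    proof -
      have "(1 / 2)\<^sup>2 \<le> (1 - \<bar>x i\<bar>)\<^sup>2" using False by (intro power_mono) auto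
      also have "\<dots> = b\<^sup>2" by (simp add: b_def power2_commute)
      finally show ?thesis using b by (simp add: power2_eq_square)
    qed
    have "(M i j)\<^sup>2 \<le> 4" if "j < n" for j
      using power_mono[OF M[OF that], of 2] by simp
    then have M2: "(\<Sum>j<n. (M i j)\<^sup>2) \<le> 4 * n"
      using sum_bounded_above[of "{..<n}" "\<lambda>j. (M i j)\<^sup>2" 4] by (simp add: mult.commute)
    have "(\<Sum>j<n. (x j)\<^sup>2) \<le> (\<Sum>j<n. 2 * (\<bar>x j\<bar> - 1)\<^sup>2 + 2)"
    proof (rule sum_mono)
      fix j
      have "0 \<le> (\<bar>x j\<bar> - 2)\<^sup>2" by simp
      then show "(x j)\<^sup>2 \<le> 2 * (\<bar>x j\<bar> - 1)\<^sup>2 + 2" by (simp add: power2_diff)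
    qed
    also have "\<dots> = 2 * D + 2 * n" by (simp add: D_def sum.distrib sum_distrib_left)
    finally have x2: "(\<Sum>j<n. (x j)\<^sup>2) \<le> 2 * D + 2 * n" .
    have "(mat_app n M x i)\<^sup>2 \<le> (\<Sum>j<n. (M i j)\<^sup>2) * (\<Sum>j<n. (x j)\<^sup>2)"
      unfolding mat_app_def by (rule Cauchy_Schwarz_ineq_sum)
    also have "\<dots> \<le> (4 * n) * (2 * D + 2 * n)"
      using M2 x2 by (intro mult_mono) (auto intro: sum_nonneg)
    also have "\<dots> = 8 * (n * D) + 8 * real n ^ 2" by (simp add: algebra_simps power2_eq_square)
    also have "\<dots> \<le> 8 * (real n ^ 2 * D) + 32 * (real n ^ 2 * D)"
    proof -
      have "real n * D \<le> real n ^ 2 * D"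
        using n D by (intro mult_right_mono) (auto simp: self_le_power)
      moreover have "real n ^ 2 * (1 / 4) \<le> real n ^ 2 * D" using \<open>1 / 4 \<le> D\<close> by (intro mult_left_mono) auto
      ultimately show ?thesis by linarith
    qed
    also have "\<dots> \<le> 2 - (x i)\<^sup>2 + (13 * D + 40 * (real n ^ 2 * D))"
    proof -
      have "(x i)\<^sup>2 \<le> 1" using False by (simp add: abs_square_le_1)
      then show ?thesis using D by linarith
    qed
    finally show ?thesis by (simp add: D_def algebra_simps)
  qed
qed

section \<open>Extremal configurations are orthonormal\<close>

text \<open>
  The assumption \<open>bound\<close> is the squared, homogeneous form of the upper bound \<open>n\<^sup>-\<^sup>n\<^sup>/\<^sup>2\<close> for the supremum, in terms of the
  coefficients of a linear combination of the given vectors. Averaging the pointwise estimates over the critical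
  points of \<open>A + \<delta> I\<close> shows \<open>A\<^sub>k\<^sub>l\<^sup>2 = O(\<delta>)\<close>.
\<close>

lemma extremal_gram_matrix_offdiagonal:
  assumes n: "0 < n" and sym: "\<And>i j. A i j = A j i" and diag: "\<And>i. i < n \<Longrightarrow> A i i = 1"
    and le1: "\<And>i j. i < n \<Longrightarrow> j < n \<Longrightarrow> \<bar>A i j\<bar> \<le> 1"
    and psd: "\<And>x. 0 \<le> quad_form n A x"
    and bound: "\<And>x. (\<Prod>i<n. (mat_app n A x i)\<^sup>2) \<le> (quad_form n A x / n) ^ n"
    and k: "k < n" and l: "l < n" and kl: "k \<noteq> l"
  shows "A k l = 0"
proof -
  have small: "(A k l)\<^sup>2 \<le> 159 * real n ^ 3 * \<delta>" if \<delta>: "0 < \<delta>" "\<delta> * (2 * real n ^ 2) \<le> 1" for \<delta>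
  proof -
    define B where "B i j = A i j + (if i = j then \<delta> else 0)" for i j
    have appB: "mat_app n B x i = mat_app n A x i + \<delta> * x i" if "i < n" for x i
    proof -
      have "mat_app n B x i = (\<Sum>j<n. A i j * x j + (if i = j then \<delta> * x j else 0))"
        unfolding mat_app_def B_def by (intro sum.cong) (auto simp: algebra_simps)
      then show ?thesis using that by (simp add: mat_app_def sum.distrib)
    qed
    have quadB: "quad_form n B x = quad_form n A x + \<delta> * (\<Sum>i<n. (x i)\<^sup>2)" for x
    proof -
      have "quad_form n B x = (\<Sum>i<n. x i * mat_app n A x i + \<delta> * (x i)\<^sup>2)"
        unfolding quad_form_def by (intro sum.cong) (auto simp: appB algebra_simps power2_eq_square)
      then show ?thesis by (simp add: quad_form_def sum.distrib sum_distrib_left)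
    qed
    have pdB: "positive_definite n B"
      unfolding positive_definite_def
    proof (intro allI impI)
      fix x :: "nat \<Rightarrow> real" assume "\<exists>i<n. x i \<noteq> 0"
      then obtain i where "i < n" "x i \<noteq> 0" by blast
      then have "0 < (\<Sum>i<n. (x i)\<^sup>2)" by (intro sum_pos2[of _ i]) auto
      then show "0 < quad_form n B x" using psd[of x] \<delta>(1) by (simp add: quadB add_nonneg_pos)
    qed
    have symB: "B i j = B j i" for i j using sym by (simp add: B_def)
    obtain x :: "nat set \<Rightarrow> nat \<Rightarrow> real" and \<mu> where
      crit: "\<And>P i. i < n \<Longrightarrow> x P i * mat_app n B (x P) i = 1" and
      \<mu>: "\<And>P. 0 \<le> \<mu> P" and total: "(\<Sum>P\<in>Pow {0..<n}. \<mu> P) = 1" and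
      moments: "\<And>i j. i < n \<Longrightarrow> j < n \<Longrightarrow>
        (\<Sum>P\<in>Pow {0..<n}. \<mu> P * (x P i * x P j)) * B j j = (if i = j then 1 else 0)"
      by (rule critical_point_moments[OF n symB pdB]) (rule that)
    define E where "E f = (\<Sum>P\<in>Pow {0..<n}. \<mu> P * f P)" for f :: "nat set \<Rightarrow> real"
    have E_mono: "E f \<le> E g" if "\<And>P. f P \<le> g P" for f g
      unfolding E_def using that \<mu> by (intro sum_mono mult_left_mono) auto
    have E_add: "E (\<lambda>P. f P + g P) = E f + E g" for f g
      by (simp add: E_def sum.distrib algebra_simps)
    have E_diff: "E (\<lambda>P. f P - g P) = E f - E g" for f g
      by (simp add: E_def sum_subtractf algebra_simps)
    have E_scale: "E (\<lambda>P. c * f P) = c * E f" for c f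
      by (simp add: E_def sum_distrib_left mult_ac)
    have E_const: "E (\<lambda>P. c) = c" for c
      using total by (simp add: E_def sum_distrib_right[symmetric])
    have E_sum: "E (\<lambda>P. \<Sum>i<n. f i P) = (\<Sum>i<n. E (f i))" for f :: "nat \<Rightarrow> nat set \<Rightarrow> real"
      unfolding E_def sum_distrib_left by (rule sum.swap)
    have Exx: "(1 + \<delta>) * E (\<lambda>P. x P i * x P j) = (if i = j then 1 else 0)" if "i < n" "j < n" for i j
      using moments[OF that] diag[OF that(2)] by (simp add: E_def B_def mult.commute)
    define S where "S P = (\<Sum>i<n. (x P i)\<^sup>2)" for P
    define D where "D P = (\<Sum>i<n. (\<bar>x P i\<bar> - 1)\<^sup>2)" for P
    have ES: "(1 + \<delta>) * E S = n"
      unfolding S_def E_sum sum_distrib_left using Exx by (simp add: power2_eq_square)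
    have "D P \<le> (1 + 4 * \<delta>) * S P - n" for P
    proof -
      have "D P \<le> S P - n + 4 * \<delta> * S P"
        unfolding D_def S_def using crit[of _ P] appB
        by (intro critical_point_deviation[OF n \<delta> _ psd bound]) simp
      then show ?thesis by (simp add: algebra_simps)
    qed
    then have "E D \<le> (1 + 4 * \<delta>) * E S - n"
      using E_mono[of D "\<lambda>P. (1 + 4 * \<delta>) * S P - n"] by (simp add: E_diff E_scale E_const)
    then have "(1 + \<delta>) * E D \<le> (1 + 4 * \<delta>) * ((1 + \<delta>) * E S) - (1 + \<delta>) * n"
      using \<delta>(1) mult_left_mono[of "E D" "(1 + 4 * \<delta>) * E S - n" "1 + \<delta>"] by (simp add: algebra_simps)
    then have ED: "(1 + \<delta>) * E D \<le> 3 * \<delta> * n"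
      unfolding ES by (simp add: algebra_simps)
    have "0 \<le> E D"
      unfolding E_def D_def by (intro sum_nonneg mult_nonneg_nonneg \<mu> zero_le_power2)
    then have ED0: "0 \<le> (1 + \<delta>) * E D" using \<delta>(1) by simp
    define y where "y P = mat_app n B (x P) k" for P
    have \<delta>1: "\<delta> \<le> 1"
    proof -
      have "\<delta> * 1 \<le> \<delta> * (2 * real n ^ 2)"
        using n \<delta>(1) by (intro mult_left_mono) (auto simp: one_le_power order_trans[of 1 "real n ^ 2"])
      then show ?thesis using \<delta>(2) by simp
    qed
    have "\<bar>B k j\<bar> \<le> 2" if "j < n" for j
      using le1[OF k that] \<delta>(1) \<delta>1 by (auto simp: B_def)
    then have "(y P)\<^sup>2 \<le> 2 - (x P k)\<^sup>2 + (13 + 40 * real n ^ 2) * D P" for P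
      unfolding y_def D_def by (intro critical_point_reciprocal_bound n k crit) auto
    then have "E (\<lambda>P. (y P)\<^sup>2) \<le> E (\<lambda>P. 2 - (x P k)\<^sup>2 + (13 + 40 * real n ^ 2) * D P)"
      by (rule E_mono)
    then have "(1 + \<delta>) * E (\<lambda>P. (y P)\<^sup>2)
        \<le> (1 + \<delta>) * (2 - E (\<lambda>P. (x P k)\<^sup>2) + (13 + 40 * real n ^ 2) * E D)"
      using \<delta>(1) by (intro mult_left_mono) (simp_all add: E_add E_diff E_scale E_const)
    also have "\<dots> = 2 * (1 + \<delta>) - (1 + \<delta>) * E (\<lambda>P. (x P k)\<^sup>2) + (13 + 40 * real n ^ 2) * ((1 + \<delta>) * E D)"
      by (simp add: algebra_simps)
    also have "\<dots> = 2 * (1 + \<delta>) - 1 + (13 + 40 * real n ^ 2) * ((1 + \<delta>) * E D)"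
      using Exx[OF k k] by (simp add: power2_eq_square)
    also have "\<dots> \<le> 1 + 2 * \<delta> + (53 * real n ^ 2) * (3 * \<delta> * n)"
    proof -
      have "1 \<le> real n ^ 2" using n by (simp add: one_le_power)
      then have "(13 + 40 * real n ^ 2) * ((1 + \<delta>) * E D) \<le> (53 * real n ^ 2) * (3 * \<delta> * n)"
        using ED0 by (intro mult_mono ED) auto
      moreover have "2 * (1 + \<delta>) - 1 = 1 + 2 * \<delta>" by simp
      ultimately show ?thesis by (simp only: add_left_mono)
    qed
    finally have upper: "(1 + \<delta>) * E (\<lambda>P. (y P)\<^sup>2) \<le> 1 + 2 * \<delta> + 159 * real n ^ 3 * \<delta>"
      by (simp add: power3_eq_cube power2_eq_square algebra_simps)
    (* As y is linear in x, its moments against x recover row k of B, and the mean of y^2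
       is the squared norm of that row up to the factor 1 + \<delta>. *)
    have Eyx: "(1 + \<delta>) * E (\<lambda>P. y P * x P j) = B k j" if j: "j < n" for j
    proof -
      have "y P * x P j = (\<Sum>i<n. B k i * (x P i * x P j))" for P
        unfolding y_def mat_app_def sum_distrib_right by (simp only: mult.assoc)
      then have "(1 + \<delta>) * E (\<lambda>P. y P * x P j) = (\<Sum>i<n. B k i * ((1 + \<delta>) * E (\<lambda>P. x P i * x P j)))"
        by (simp add: E_sum E_scale sum_distrib_left mult_ac)
      also have "\<dots> = (\<Sum>i<n. if i = j then B k i else 0)"
        using Exx j by (intro sum.cong) auto
      finally show ?thesis using j by simp
    qed
    have y2: "(y P)\<^sup>2 = (\<Sum>j<n. B k j * (y P * x P j))" for P
    proof -
      have "(y P)\<^sup>2 = y P * (\<Sum>j<n. B k j * x P j)"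
        by (simp add: power2_eq_square y_def mat_app_def)
      then show ?thesis by (simp only: sum_distrib_left mult.left_commute)
    qed
    have "(1 + \<delta>) * E (\<lambda>P. (y P)\<^sup>2) = (\<Sum>j<n. B k j * ((1 + \<delta>) * E (\<lambda>P. y P * x P j)))"
      unfolding y2 E_sum E_scale sum_distrib_left by (simp only: mult.left_commute)
    also have "\<dots> = (\<Sum>j<n. (B k j)\<^sup>2)"
      using Eyx by (intro sum.cong) (auto simp: power2_eq_square)
    also have "\<dots> \<ge> (\<Sum>j\<in>{k, l}. (B k j)\<^sup>2)"
      using k l by (intro sum_mono2) auto
    finally have "(1 + \<delta>)\<^sup>2 + (A k l)\<^sup>2 \<le> (1 + \<delta>) * E (\<lambda>P. (y P)\<^sup>2)"
      using kl diag[OF k] by (simp add: B_def)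
    then have "(A k l)\<^sup>2 + \<delta>\<^sup>2 \<le> 159 * real n ^ 3 * \<delta>"
      using upper by (simp add: power2_sum)
    then show ?thesis by (meson le_add_same_cancel1 order_trans zero_le_power2)
  qed
  show ?thesis
  proof (rule ccontr)
    assume "A k l \<noteq> 0"
    then have a: "0 < (A k l)\<^sup>2" by simp
    define \<delta> where "\<delta> = min (1 / (2 * real n ^ 2)) ((A k l)\<^sup>2 / (2 * (159 * real n ^ 3)))"
    have "0 < \<delta>" using a n by (simp add: \<delta>_def)
    moreover have "\<delta> \<le> 1 / (2 * real n ^ 2)" by (simp add: \<delta>_def)
    then have "\<delta> * (2 * real n ^ 2) \<le> 1" using n by (simp add: field_simps)
    ultimately have "(A k l)\<^sup>2 \<le> 159 * real n ^ 3 * \<delta>" by (rule small)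
    moreover have "\<delta> \<le> (A k l)\<^sup>2 / (2 * (159 * real n ^ 3))" by (simp add: \<delta>_def)
    then have "159 * real n ^ 3 * \<delta> \<le> (A k l)\<^sup>2 / 2" using n by (simp add: field_simps)
    ultimately show False using a by linarith
  qed
qed

theorem theorem2:
  fixes n :: nat and v :: "nat \<Rightarrow> real ^ 'd"
  assumes "n \<ge> 1"
    and "\<And>j. j \<in> {1..n} \<Longrightarrow> v j \<in> sphere 0 1"
    and "(SUP u \<in> sphere (0 :: real ^ 'd) 1. \<Prod>j=1..n. \<bar>v j \<bullet> u\<bar>) = real n powr (- (real n / 2))"
  shows "CARD('d) \<ge> n \<and>
    (\<forall>j\<in>{1..n}. \<forall>k\<in>{1..n}. v j \<bullet> v k = (if j = k then 1 else 0))"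
proof -
  have n: "0 < n" using assms(1) by simp
  define w where "w i = v (Suc i)" for i
  have w: "norm (w i) = 1" if "i < n" for i
    using assms(2)[of "Suc i"] that by (simp add: w_def)
  have prod_w: "(\<Prod>j=1..n. \<bar>v j \<bullet> u\<bar>) = (\<Prod>i<n. \<bar>w i \<bullet> u\<bar>)" for u
    unfolding w_def by (rule prod.reindex_bij_witness[of _ Suc "\<lambda>j. j - 1"]) auto
  have cs: "\<bar>w i \<bullet> u\<bar> \<le> norm u" if "i < n" for i u
    using Cauchy_Schwarz_ineq2[of "w i" u] w[OF that] by simp
  have sphere_bound: "(\<Prod>i<n. \<bar>w i \<bullet> u\<bar>) \<le> real n powr (- (real n / 2))" if "norm u = 1" for u
    unfolding assms(3)[symmetric] prod_w
  proof (rule cSUP_upper)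
    show "bdd_above ((\<lambda>u. \<Prod>i<n. \<bar>w i \<bullet> u\<bar>) ` sphere 0 1)"
    proof (rule bdd_aboveI2)
      fix u :: "real ^ 'd" assume "u \<in> sphere 0 1"
      then have "\<bar>w i \<bullet> u\<bar> \<le> 1" if "i < n" for i using cs[OF that, of u] by simp
      then show "(\<Prod>i<n. \<bar>w i \<bullet> u\<bar>) \<le> 1" by (intro prod_le_1) auto
    qed
  qed (use that in simp)
  have bound: "(\<Prod>i<n. (w i \<bullet> u)\<^sup>2) \<le> (u \<bullet> u / n) ^ n" for u
  proof (cases "u = 0")
    case True
    have "(\<Prod>i<n. (w i \<bullet> u)\<^sup>2) = 0" using True n by (intro prod_zero) auto
    then show ?thesis using True n by (simp add: power_0_left)
  next
    case False
    define e where "e = u /\<^sub>R norm u"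
    have "norm e = 1" using False by (simp add: e_def)
    have "(\<Prod>i<n. (w i \<bullet> e)\<^sup>2) = (\<Prod>i<n. \<bar>w i \<bullet> e\<bar>)\<^sup>2"
      by (simp add: prod_power_distrib)
    also have "\<dots> \<le> (real n powr (- (real n / 2)))\<^sup>2"
      using sphere_bound[OF \<open>norm e = 1\<close>] by (intro power_mono prod_nonneg) auto
    also have "\<dots> = 1 / real n ^ n"
    proof -
      have "(real n powr (- (real n / 2)))\<^sup>2 = real n powr (- real n)"
        unfolding power2_eq_square powr_add[symmetric] by simp
      also have "\<dots> = inverse (real n powr real n)" by (rule powr_minus)
      also have "real n powr real n = real n ^ n" using n by (intro powr_realpow) simp
      finally show ?thesis by (simp add: inverse_eq_divide)
    qed
    finally have "(\<Prod>i<n. (w i \<bullet> e)\<^sup>2) \<le> 1 / real n ^ n" .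
    moreover have "(\<Prod>i<n. (w i \<bullet> u)\<^sup>2) = (u \<bullet> u) ^ n * (\<Prod>i<n. (w i \<bullet> e)\<^sup>2)"
    proof -
      have "(w i \<bullet> u)\<^sup>2 = (u \<bullet> u) * (w i \<bullet> e)\<^sup>2" for i
        using False by (simp add: e_def power_mult_distrib power_inverse dot_square_norm)
      then show ?thesis by (simp add: prod.distrib)
    qed
    ultimately show ?thesis
      using mult_left_mono[of _ "1 / real n ^ n" "(u \<bullet> u) ^ n"] by (simp add: power_divide)
  qed
  define A where "A i j = w i \<bullet> w j" for i j
  define comb where "comb x = (\<Sum>j<n. x j *\<^sub>R w j)" for x
  have app: "mat_app n A x i = w i \<bullet> comb x" for x i
    by (simp add: mat_app_def A_def comb_def inner_sum_right mult.commute)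
  have quad: "quad_form n A x = comb x \<bullet> comb x" for x
    unfolding quad_form_def app by (subst (2) comb_def) (simp add: inner_sum_left)
  have offdiag: "w i \<bullet> w j = 0" if "i < n" "j < n" "i \<noteq> j" for i j
  proof -
    have "A i j = 0"
    proof (rule extremal_gram_matrix_offdiagonal[OF n _ _ _ _ _ that])
      show "A i j = A j i" for i j by (simp add: A_def inner_commute)
      show "A i i = 1" if "i < n" for i using w[OF that] by (simp add: A_def dot_square_norm)
      show "\<bar>A i j\<bar> \<le> 1" if "i < n" "j < n" for i j
        using cs[OF that(1), of "w j"] w[OF that(2)] by (simp add: A_def)
      show "0 \<le> quad_form n A x" for x by (simp add: quad)
      show "(\<Prod>i<n. (mat_app n A x i)\<^sup>2) \<le> (quad_form n A x / n) ^ n" for x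
        unfolding app quad by (rule bound)
    qed
    then show ?thesis by (simp add: A_def)
  qed
  have orth: "v j \<bullet> v k = (if j = k then 1 else 0)" if "j \<in> {1..n}" "k \<in> {1..n}" for j k
    using offdiag[of "j - 1" "k - 1"] assms(2)[OF that(1)] that
    by (auto simp: w_def dot_square_norm)
  have inj: "inj_on v {1..n}"
    by (rule inj_onI) (metis orth zero_neq_one)
  have "independent (v ` {1..n})"
  proof (rule pairwise_orthogonal_independent)
    show "pairwise real_inner_class.orthogonal (v ` {1..n})"
      using orth by (auto simp: pairwise_def real_inner_class.orthogonal_def)
    show "0 \<notin> v ` {1..n}"
      using orth by force
  qed
  then have "card (v ` {1..n}) \<le> CARD('d)"
    using independent_bound by fastforce
  then show ?thesis using inj orth by (simp add: card_image)
qed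

end
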